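(* Let $d>2$ be a prime number, let $X\in M(d,\mathbb{C})$ be a unitary matrix with $X^d=\mathbb{I}_d$ and $\operatorname{Tr}(X^iX^{j\dagger})=0$ for all $i\neq j$ in $\{0,\dots,d-1\}$, and let $M_s$ be the $d$-dimensional subspace of $M(d,\mathbb{C})$ with basis $X^{(0)}=\{\mathbb{I}_d,X,X^2,\dots,X^{d-1}\}$. Let $\omega=\exp(2\pi i/d)$ and, for $r=1,\dots,d-1$ and $s=0,\dots,d-1$, let $$X_s^{(r)}=\frac{1}{\sqrt d}\sum_{k=0}^{d-1}(\omega^s)^{d-k}(\omega^{-r})^{\alpha_{(k)}}X^k,\qquad \alpha_{(k)}=k+(k+1)+\dots+(d-1).$$ Then for every $r=1,\dots,d-1$ the set $X^{(r)}=\{X^{(r)}_0,\dots,X^{(r)}_{d-1}\}$ is an orthogonal basis of $M_s$ consisting of unitary matrices, it is MUUB with respect to $X^{(0)}$, and the bases $X^{(1)},\dots,X^{(d-1)}$ are pairwise MUUB.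
   Context: $M(d,\mathbb{C})$ is the vector space of $d\times d$ complex matrices with inner product $(A,B)\mapsto\operatorname{Tr}(A^\dagger B)$, where $\dagger$ is the conjugate transpose; $\mathbb{I}_d$ is the identity matrix. Definition (MUUB, Mutually Unbiased Unitary Bases): let $V$ be an $n$-dimensional subspace of $M(d,\mathbb{C})$. Two distinct orthogonal bases of $V$ consisting of unitary matrices, $A^{(0)}=\{A^{(0)}_0,\dots,A^{(0)}_{n-1}\}$ and $A^{(1)}=\{A^{(1)}_0,\dots,A^{(1)}_{n-1}\}$, are MUUB if there is a constant $C\neq 0$ such that $|\operatorname{Tr}(A_i^{(0)\dagger}A_j^{(1)})|^2=C$ for all $i,j=0,\dots,n-1$. *)

theory Defs
  imports "HOL-Analysis.Analysis" "HOL-Computational_Algebra.Primes"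
begin

text \<open>
  The space \<open>M(d, \<complex>)\<close> is the type \<open>complex^'n^'n\<close> with \<open>d = CARD('n)\<close>. The matrix product is \<open>**\<close>;
  the overloaded \<open>*\<close> on this type is componentwise.
\<close>

definition cmat_scale :: "complex \<Rightarrow> complex^'n^'m \<Rightarrow> complex^'n^'m"  (infixr "*\<^sub>m" 75)
  where "c *\<^sub>m A = (\<chi> i j. c * A $ i $ j)"

text \<open>The interpretation provides complex-linear \<open>cmat.span\<close>, \<open>cmat.subspace\<close>, \<open>cmat.dim\<close>, and
  \<open>cmat.independent\<close>; the unqualified library constants of these names are real-linear.\<close>

global_interpretation cmat: vector_space "cmat_scale :: complex \<Rightarrow> complex^'n^'m \<Rightarrow> complex^'n^'m"
  by unfold_locales (auto simp: cmat_scale_def vec_eq_iff algebra_simps)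

definition ctranspose :: "complex^'n^'m \<Rightarrow> complex^'m^'n"
  where "ctranspose A = (\<chi> i j. cnj (A $ j $ i))"

definition unitary_mat :: "complex^'n^'n \<Rightarrow> bool"
  where "unitary_mat U \<longleftrightarrow> ctranspose U ** U = mat 1 \<and> U ** ctranspose U = mat 1"

primrec mat_pow :: "complex^'n^'n \<Rightarrow> nat \<Rightarrow> complex^'n^'n" where
  "mat_pow X 0 = mat 1"
| "mat_pow X (Suc k) = X ** mat_pow X k"

definition hs_inner :: "complex^'n^'n \<Rightarrow> complex^'n^'n \<Rightarrow> complex"
  where "hs_inner A B = trace (ctranspose A ** B)"

text \<open>Bases with \<open>n\<close> elements are families of which only the members with index below \<open>n\<close> matter.\<close>

definition orthogonal_unitary_basis ::
    "nat \<Rightarrow> (complex^'n^'n) set \<Rightarrow> (nat \<Rightarrow> complex^'n^'n) \<Rightarrow> bool"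
  where "orthogonal_unitary_basis n V A \<longleftrightarrow>
    inj_on A {..<n} \<and> cmat.independent (A ` {..<n}) \<and> cmat.span (A ` {..<n}) = V \<and>
    (\<forall>i<n. \<forall>j<n. i \<noteq> j \<longrightarrow> hs_inner (A i) (A j) = 0) \<and>
    (\<forall>i<n. unitary_mat (A i))"

definition MUUB ::
    "nat \<Rightarrow> (complex^'n^'n) set \<Rightarrow> (nat \<Rightarrow> complex^'n^'n) \<Rightarrow> (nat \<Rightarrow> complex^'n^'n) \<Rightarrow> bool"
  where "MUUB n V A B \<longleftrightarrow>
    cmat.subspace V \<and> cmat.dim V = n \<and>
    orthogonal_unitary_basis n V A \<and> orthogonal_unitary_basis n V B \<and>
    A ` {..<n} \<noteq> B ` {..<n} \<and>
    (\<exists>C::real. C \<noteq> 0 \<and> (\<forall>i<n. \<forall>j<n. (cmod (hs_inner (A i) (B j)))\<^sup>2 = C))"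

definition root_unity :: "nat \<Rightarrow> complex"
  where "root_unity d = exp (2 * of_real pi * \<i> / of_nat d)"

definition alpha :: "nat \<Rightarrow> nat \<Rightarrow> nat"
  where "alpha d k = (\<Sum>j = k..d - 1. j)"

definition Xfam :: "nat \<Rightarrow> complex^'n^'n \<Rightarrow> nat \<Rightarrow> nat \<Rightarrow> complex^'n^'n"
  where "Xfam d X r s = complex_of_real (1 / sqrt (real d)) *\<^sub>m
    (\<Sum>k = 0..d - 1.
      ((root_unity d ^ s) ^ (d - k) * (root_unity d powi (- int r)) ^ alpha d k) *\<^sub>m mat_pow X k)"

end

theory Submission
  imports Defs
begin

text \<open>
  Up to the factor \<open>1 / sqrt d\<close>, the coefficients of \<open>X\<^sub>s\<^sup>(\<^sup>r\<^sup>)\<close> in the powers of \<open>X\<close> form the quadratic chirp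
  \<open>q\<^bsup>k(k-1)/2\<^esup> z\<^sup>k\<close> with \<open>q = \<omega>\<^sup>r\<close> and \<open>z = \<omega>\<^bsup>-s\<^esup>\<close>. For odd \<open>d\<close> it is \<open>d\<close>-periodic, and for
  \<open>q\<close> of order \<open>d\<close> its cyclic autocorrelation is \<open>d\<close> times a Kronecker delta. Applied to the coefficients
  this gives unitarity. The pointwise product of a chirp with a conjugate chirp is again a chirp,
  so the same autocorrelation identity, summed over all shifts, shows that the (Gauss) sums giving
  the inner products between \<open>X\<^sup>(\<^sup>r\<^sup>)\<close> and \<open>X\<^sup>(\<^sup>r\<^sup>'\<^sup>)\<close> have squared modulus \<open>d\<close>.
\<close>

section \<open>Matrices and the Hilbert-Schmidt form\<close>

lemma ctranspose_sum: "ctranspose (sum f A) = (\<Sum>k\<in>A. ctranspose (f k))"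
  by (simp add: ctranspose_def vec_eq_iff)

lemma ctranspose_scale: "ctranspose (c *\<^sub>m A) = cnj c *\<^sub>m ctranspose A"
  by (simp add: ctranspose_def cmat_scale_def vec_eq_iff)

lemma ctranspose_mult: "ctranspose (A ** B) = ctranspose B ** ctranspose A"
  by (simp add: ctranspose_def matrix_matrix_mult_def vec_eq_iff mult.commute)

lemma ctranspose_mat_1 [simp]: "ctranspose (mat 1) = mat 1"
  by (simp add: ctranspose_def mat_def vec_eq_iff eq_commute)

lemma matrix_mult_sum_left:
  fixes f :: "'a \<Rightarrow> 'b::semiring_1^'n^'m"
  shows "sum f A ** B = (\<Sum>k\<in>A. f k ** B)"
  by (induction A rule: infinite_finite_induct) (simp_all add: matrix_matrix_mult_def vec_eq_iff distrib_right sum.distrib)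

lemma matrix_mult_sum_right:
  fixes f :: "'a \<Rightarrow> 'b::semiring_1^'n^'m"
  shows "B ** sum f A = (\<Sum>k\<in>A. B ** f k)"
  by (induction A rule: infinite_finite_induct) (simp_all add: matrix_add_ldistrib)

lemma matrix_mult_scale_left: "(c *\<^sub>m A) ** B = c *\<^sub>m (A ** B)"
  by (simp add: cmat_scale_def matrix_matrix_mult_def vec_eq_iff sum_distrib_left mult.assoc)

lemma matrix_mult_scale_right: "A ** (c *\<^sub>m B) = c *\<^sub>m (A ** B)"
  by (simp add: cmat_scale_def matrix_matrix_mult_def vec_eq_iff sum_distrib_left mult.left_commute)

lemma trace_sum: "trace (sum f A) = (\<Sum>k\<in>A. trace (f k))"
  unfolding trace_def by (simp add: sum.swap [of _ A])

lemma trace_scale: "trace (c *\<^sub>m A) = c * trace A"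
  by (simp add: trace_def cmat_scale_def sum_distrib_left)

lemmas hs_inner_simps = hs_inner_def ctranspose_sum ctranspose_scale matrix_mult_sum_left
  matrix_mult_sum_right matrix_mult_scale_left matrix_mult_scale_right trace_sum trace_scale

lemma hs_inner_sum_left: "hs_inner (sum f A) B = (\<Sum>k\<in>A. hs_inner (f k) B)"
  by (simp add: hs_inner_simps)

lemma hs_inner_sum_right: "hs_inner B (sum f A) = (\<Sum>k\<in>A. hs_inner B (f k))"
  by (simp add: hs_inner_simps)

lemma hs_inner_scale_left: "hs_inner (c *\<^sub>m A) B = cnj c * hs_inner A B"
  by (simp add: hs_inner_simps)

lemma hs_inner_scale_right: "hs_inner A (c *\<^sub>m B) = c * hs_inner A B"
  by (simp add: hs_inner_simps)

lemma hs_inner_unitary_self: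
  fixes U :: "complex^'n^'n"
  assumes "unitary_mat U"
  shows "hs_inner U U = of_nat CARD('n)"
  using assms by (simp add: hs_inner_def unitary_mat_def trace_def mat_def)

lemma unitary_matI:
  assumes "ctranspose U ** U = mat 1"
  shows "unitary_mat U"
  using assms matrix_left_right_inverse unfolding unitary_mat_def by blast

lemma mat_pow_add: "mat_pow X (k + m) = mat_pow X k ** mat_pow X m"
  by (induction k) (simp_all add: matrix_mul_assoc)

lemma unitary_mat_pow:
  assumes "unitary_mat X"
  shows "unitary_mat (mat_pow X k)"
proof (rule unitary_matI, induction k)
  case (Suc k)
  have "ctranspose (mat_pow X (Suc k)) ** mat_pow X (Suc k)
      = ctranspose (mat_pow X k) ** ((ctranspose X ** X) ** mat_pow X k)"
    by (simp add: ctranspose_mult matrix_mul_assoc)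
  then show ?case
    using assms Suc by (simp add: unitary_mat_def)
qed simp

section \<open>Orthogonal bases of unitary matrices\<close>

text \<open>Unitarity gives \<open>hs_inner (A i) (A i) = CARD('n)\<close>, which is nonzero. So
  equal members cannot be orthogonal, and pairing a vanishing combination with \<open>A i\<close>
  isolates its i-th coefficient.\<close>

lemma orthogonal_unitary_inj_independent:
  fixes A :: "nat \<Rightarrow> complex^'n^'n"
  assumes orth: "\<And>i j. i < n \<Longrightarrow> j < n \<Longrightarrow> i \<noteq> j \<Longrightarrow> hs_inner (A i) (A j) = 0"
    and unit: "\<And>i. i < n \<Longrightarrow> unitary_mat (A i)"
  shows "inj_on A {..<n}" and "cmat.independent (A ` {..<n})"
proof -
  have self: "hs_inner (A i) (A i) \<noteq> 0" if "i < n" for i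
    using hs_inner_unitary_self [OF unit [OF that]] by simp
  show inj: "inj_on A {..<n}"
    using orth self by (metis inj_onI lessThan_iff)
  show "cmat.independent (A ` {..<n})"
  proof (rule cmat.independent_if_scalars_zero)
    fix u x assume zero: "(\<Sum>x\<in>A ` {..<n}. u x *\<^sub>m x) = 0" and "x \<in> A ` {..<n}"
    then obtain i where i: "i < n" "x = A i" by auto
    have "0 = hs_inner (A i) (\<Sum>j<n. u (A j) *\<^sub>m A j)"
      using zero by (simp add: sum.reindex [OF inj] hs_inner_def trace_def)
    also have "\<dots> = (\<Sum>j<n. if j = i then u (A i) * hs_inner (A i) (A i) else 0)"
      unfolding hs_inner_sum_right hs_inner_scale_right using i orth by (intro sum.cong) auto
    also have "\<dots> = u x * hs_inner (A i) (A i)"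
      using i by simp
    finally show "u x = 0" using self [OF i(1)] by simp
  qed simp
qed

text \<open>Spanning follows by counting: a vector of the span of \<open>B\<close> outside the span
  of \<open>A\<close> would give n + 1 independent vectors inside the span of at most n
  vectors.\<close>

lemma orthogonal_unitary_basisI:
  fixes A B :: "nat \<Rightarrow> complex^'n^'n"
  assumes orth: "\<And>i j. i < n \<Longrightarrow> j < n \<Longrightarrow> i \<noteq> j \<Longrightarrow> hs_inner (A i) (A j) = 0"
    and unit: "\<And>i. i < n \<Longrightarrow> unitary_mat (A i)"
    and sub: "\<And>i. i < n \<Longrightarrow> A i \<in> cmat.span (B ` {..<n})"
  shows "orthogonal_unitary_basis n (cmat.span (B ` {..<n})) A"
proof -
  note indep = orthogonal_unitary_inj_independent [OF orth unit]
  have le: "cmat.span (A ` {..<n}) \<subseteq> cmat.span (B ` {..<n})"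
    using sub by (intro cmat.span_minimal cmat.subspace_span) auto
  have "v \<in> cmat.span (A ` {..<n})" if v: "v \<in> cmat.span (B ` {..<n})" for v
  proof (rule ccontr)
    assume nv: "v \<notin> cmat.span (A ` {..<n})"
    then have "v \<notin> A ` {..<n}" by (auto intro: cmat.span_base)
    moreover have "cmat.independent (insert v (A ` {..<n}))"
      using indep nv by (simp add: cmat.independent_insertI)
    then have "card (insert v (A ` {..<n})) \<le> card (B ` {..<n})"
      using sub v by (intro conjunct2 [OF cmat.independent_span_bound]) auto
    ultimately show False
      using card_image [OF indep(1)] card_image_le [of "{..<n}" B] by simp
  qed
  with le have "cmat.span (A ` {..<n}) = cmat.span (B ` {..<n})" by blast
  with indep orth unit show ?thesis
    by (simp add: orthogonal_unitary_basis_def)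
qed

lemma MUUBI:
  fixes A B :: "nat \<Rightarrow> complex^'n^'n"
  assumes A: "orthogonal_unitary_basis n V A" and B: "orthogonal_unitary_basis n V B"
    and n: "0 < n" and card: "1 < CARD('n)"
    and overlap: "\<And>i j. i < n \<Longrightarrow> j < n \<Longrightarrow> (cmod (hs_inner (A i) (B j)))\<^sup>2 = CARD('n)"
  shows "MUUB n V A B"
proof -
  have V: "V = cmat.span (A ` {..<n})" and ind: "cmat.independent (A ` {..<n})"
    and inj: "inj_on A {..<n}" and U: "unitary_mat (A 0)"
    using A n by (auto simp: orthogonal_unitary_basis_def)
  have dim: "cmat.dim V = n"
    using cmat.dim_span_eq_card_independent [OF ind] card_image [OF inj] by (simp add: V)
  \<comment> \<open>A common member would have overlap \<open>CARD('n)\<close> with itself, whose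
    square exceeds \<open>CARD('n)\<close> once this number is above 1.\<close>
  have "A 0 \<noteq> B j" if "j < n" for j
  proof
    assume "A 0 = B j"
    then have "(real CARD('n))\<^sup>2 = real CARD('n)"
      using overlap [OF n that] hs_inner_unitary_self [OF U] by simp
    with card show False by (simp add: power2_eq_square)
  qed
  then have "A ` {..<n} \<noteq> B ` {..<n}"
    using n by blast
  moreover have "cmat.subspace V" by (simp add: V)
  moreover have "\<exists>C::real. C \<noteq> 0 \<and> (\<forall>i<n. \<forall>j<n. (cmod (hs_inner (A i) (B j)))\<^sup>2 = C)"
    using overlap by (intro exI [of _ "real CARD('n)"]) simp
  ultimately show ?thesis
    using A B dim by (simp add: MUUB_def)
qed

section \<open>Quadratic chirps\<close>

lemma sum_periodic_shift:
  fixes F :: "nat \<Rightarrow> 'a::ab_group_add"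
  assumes "\<And>k. F (k + d) = F k"
  shows "(\<Sum>m<d. F (k + m)) = (\<Sum>m<d. F m)"
proof (induction k)
  case (Suc k)
  have "(\<Sum>m<d. F (k + m)) + F (k + d) = F k + (\<Sum>m<d. F (Suc k + m))"
    using sum.lessThan_Suc_shift [of "\<lambda>m. F (k + m)" d] by simp
  with Suc assms [of k] show ?case by simp
qed simp

text \<open>For odd d the number (d - 1) / 2 is an integer, so d divides \<open>d choose 2\<close>.
  All uses of oddness in the chirp computations come down to this.\<close>

lemma power_choose_period_eq_1:
  fixes q :: "'a::monoid_mult"
  assumes "q ^ d = 1" "odd d"
  shows "q ^ (d choose 2) = 1"
proof -
  have "d choose 2 = d * ((d - 1) div 2)"
    using assms(2) by (simp add: choose_two div_mult_swap)
  then show ?thesis using assms(1) by (simp add: power_mult)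
qed

lemma choose_two_add: "(k + m) choose 2 = (k choose 2) + (m choose 2) + k * m"
proof (induction k)
  case (Suc k)
  have "Suc n choose 2 = (n choose 2) + n" for n
    by (simp add: numeral_2_eq_2)
  with Suc show ?case by simp
qed simp

definition chirp :: "complex \<Rightarrow> complex \<Rightarrow> nat \<Rightarrow> complex"
  where "chirp q z k = q ^ (k choose 2) * z ^ k"

lemma norm_chirp: "cmod q = 1 \<Longrightarrow> cmod z = 1 \<Longrightarrow> cmod (chirp q z k) = 1"
  by (simp add: chirp_def norm_mult norm_power)

lemma cnj_chirp_mult: "cnj (chirp q z k) * chirp q' z' k = chirp (cnj q * q') (cnj z * z') k"
  by (simp add: chirp_def power_mult_distrib)

text \<open>The cross term k m in \<open>choose_two_add\<close> becomes the factor
  \<open>(q ^ m) ^ k\<close>. For fixed m, shifting a chirp thus multiplies it by a geometric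
  sequence in k.\<close>

lemma chirp_add: "chirp q z (k + m) = chirp q z k * (chirp q z m * (q ^ m) ^ k)"
  by (simp add: chirp_def choose_two_add power_add mult.commute [of k m] flip: power_mult)

lemma chirp_periodic:
  assumes "q ^ d = 1" "z ^ d = 1" "odd d"
  shows "chirp q z (k + d) = chirp q z k"
  using assms power_choose_period_eq_1 [OF assms(1,3)] by (simp add: chirp_add) (simp add: chirp_def)

section \<open>Geometric sums, autocorrelation and Gauss sums\<close>

lemma sum_powers_root_of_unity:
  fixes w :: "'a::field"
  assumes "w ^ d = 1" "w \<noteq> 1"
  shows "(\<Sum>k<d. w ^ k) = 0"
  using assms by (simp add: geometric_sum)

text \<open>By Bezout, m x = d y + 1 for some x and y, so \<open>q ^ m = 1\<close> would force q =
  1.\<close>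

lemma prime_order_power_ne_1:
  fixes q :: "'a::field"
  assumes "prime d" "q ^ d = 1" "q \<noteq> 1" "0 < m" "m < d"
  shows "q ^ m \<noteq> 1"
proof
  assume qm: "q ^ m = 1"
  have "coprime m d"
    using assms by (metis coprime_commute nat_dvd_not_less prime_imp_coprime)
  then obtain x y where "m * x = d * y + 1"
    using coprime_bezout_strong [of m d] assms(1) by (metis not_prime_1)
  then have "(q ^ m) ^ x = (q ^ d) ^ y * q"
    by (metis power_add power_mult power_one_right)
  with qm assms show False by simp
qed

text \<open>Since chirp values have modulus 1, \<open>chirp_add\<close> leaves a constant times a
  geometric sum of ratio \<open>q ^ m\<close>. For 0 < m < d this ratio is a d-th root of unity
  other than 1, and the sum vanishes.\<close>

lemma chirp_autocorrelation:
  assumes "prime d" "q ^ d = 1" "q \<noteq> 1" and norm: "cmod q = 1" "cmod z = 1" and "m < d"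
  shows "(\<Sum>k<d. cnj (chirp q z k) * chirp q z (k + m)) = (if m = 0 then of_nat d else 0)"
proof -
  have "cnj (chirp q z k) * chirp q z k = 1" for k
    using norm_chirp [OF norm, of k] by (metis complex_norm_square mult.commute of_real_1 power_one)
  then have "cnj (chirp q z k) * chirp q z (k + m) = chirp q z m * (q ^ m) ^ k" for k
    by (simp add: chirp_add flip: mult.assoc)
  then have eq: "(\<Sum>k<d. cnj (chirp q z k) * chirp q z (k + m)) = chirp q z m * (\<Sum>k<d. (q ^ m) ^ k)"
    by (simp add: sum_distrib_left)
  show ?thesis
  proof (cases "m = 0")
    case True
    with eq show ?thesis by (simp add: chirp_def numeral_2_eq_2)
  next
    case False
    have "(q ^ m) ^ d = 1"
      using assms(2) by (metis mult.commute power_mult power_one)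
    moreover have "q ^ m \<noteq> 1"
      using prime_order_power_ne_1 [OF assms(1-3)] False \<open>m < d\<close> by simp
    ultimately have "(\<Sum>k<d. (q ^ m) ^ k) = 0"
      by (rule sum_powers_root_of_unity)
    with False eq show ?thesis by simp
  qed
qed

lemma norm_sum_chirp:
  assumes "prime d" "odd d" "q ^ d = 1" "q \<noteq> 1" "z ^ d = 1" "cmod q = 1" "cmod z = 1"
  shows "(cmod (\<Sum>k<d. chirp q z k))\<^sup>2 = d"
proof -
  let ?S = "\<Sum>k<d. chirp q z k"
  have "complex_of_real ((cmod ?S)\<^sup>2) = cnj ?S * ?S"
    by (metis complex_norm_square mult.commute)
  also have "\<dots> = (\<Sum>k<d. cnj (chirp q z k) * ?S)"
    by (simp add: sum_distrib_right)
  \<comment> \<open>By periodicity the inner sum may start at any k. Starting it at the outer index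
    makes the double sum one of autocorrelations over all shifts m.\<close>
  also have "\<dots> = (\<Sum>k<d. cnj (chirp q z k) * (\<Sum>m<d. chirp q z (k + m)))"
    using sum_periodic_shift [of "chirp q z" d] chirp_periodic assms by simp
  also have "\<dots> = (\<Sum>m<d. \<Sum>k<d. cnj (chirp q z k) * chirp q z (k + m))"
    by (subst sum.swap) (simp add: sum_distrib_left)
  also have "\<dots> = (\<Sum>m<d. if m = 0 then of_nat d else 0)"
    using assms by (intro sum.cong) (simp_all add: chirp_autocorrelation)
  also have "\<dots> = complex_of_real (real d)"
    using assms(1) by (simp add: prime_gt_0_nat)
  finally show ?thesis
    by (simp only: of_real_eq_iff)
qed

section \<open>The bases built from powers of a unitary matrix\<close>

definition chirp_mat :: "nat \<Rightarrow> complex^'n^'n \<Rightarrow> complex \<Rightarrow> complex \<Rightarrow> complex^'n^'n"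
  where "chirp_mat d X q z = complex_of_real (1 / sqrt (real d)) *\<^sub>m
    (\<Sum>k<d. chirp q z k *\<^sub>m mat_pow X k)"

section \<open>Roots of unity and the given coefficients as chirps\<close>

lemma root_unity_power:
  "root_unity d ^ k = exp (2 * of_real pi * \<i> * of_nat k / of_nat d)"
  by (simp add: root_unity_def mult_ac flip: exp_of_nat_mult)

lemma root_unity_power_eq_iff:
  "0 < d \<Longrightarrow> root_unity d ^ i = root_unity d ^ j \<longleftrightarrow> i mod d = j mod d"
  using complex_root_unity_eq [of d i j] by (simp add: root_unity_power cong_def)

lemma root_unity_power_period: "0 < d \<Longrightarrow> root_unity d ^ d = 1"
  using root_unity_power_eq_iff [of d d 0] by simp

lemma norm_root_unity: "cmod (root_unity d) = 1"
  by (simp add: root_unity_def)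

lemma cnj_root_unity: "cnj (root_unity d) = inverse (root_unity d)"
  by (metis complex_cnj_inverse complex_cnj_cnj norm_root_unity complex_div_cnj divide_complex_def
      inverse_eq_divide div_by_1 mult_1 power_one of_real_1)

text \<open>\<open>alpha d k\<close> is the tail, and \<open>k choose 2\<close> the head, of the
  triangular sum 0 + ... + (d - 1). Modulo an odd d the two are therefore negatives of each
  other.\<close>

lemma alpha_plus_choose:
  assumes "k < d"
  shows "alpha d k + (k choose 2) = d choose 2"
proof -
  have *: "(\<Sum>j<n. j) = n choose 2" for n :: nat
    by (induction n) (simp_all add: numeral_2_eq_2)
  have "{..<d} = {..<k} \<union> {k..d - 1}" "{..<k} \<inter> {k..d - 1} = {}"
    using assms by auto
  then have "(\<Sum>j<d. j) = (\<Sum>j<k. j) + alpha d k"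
    by (simp add: alpha_def sum.union_disjoint)
  then show ?thesis by (simp add: *)
qed

text \<open>Exponents of \<omega> matter only modulo d: d - k acts as -k, and -r
  \<open>alpha d k\<close> acts as r \<open>(k choose 2)\<close>. Hence the quadratic parameter is
  \<omega> to the r and the linear one is the conjugate of \<omega> to the s.\<close>

lemma Xfam_eq_chirp_mat:
  assumes "odd d"
  shows "Xfam d X r s = chirp_mat d X (root_unity d ^ r) (cnj (root_unity d) ^ s)"
proof -
  let ?w = "root_unity d"
  have d: "0 < d" using assms by (rule odd_pos)
  have nz: "?w \<noteq> 0" by (simp add: root_unity_def)
  have period: "(?w ^ n) ^ d = 1" for n
    using root_unity_power_period [OF d] by (metis mult.commute power_mult power_one)
  have "(?w ^ s) ^ (d - k) * (?w powi (- int r)) ^ alpha d k = chirp (?w ^ r) (cnj ?w ^ s) k"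
    if "k < d" for k
  proof -
    have "(?w ^ s) ^ (d - k) * (?w ^ s) ^ k = 1"
      using that period by (simp flip: power_add)
    then have 1: "(?w ^ s) ^ (d - k) = (cnj ?w ^ s) ^ k"
      using nz by (simp add: cnj_root_unity power_inverse field_simps)
    have "(?w ^ r) ^ (k choose 2) * (?w ^ r) ^ alpha d k = 1"
      using power_choose_period_eq_1 [OF period assms, of r] alpha_plus_choose [OF that]
      by (simp add: add.commute flip: power_add)
    then have "(?w powi (- int r)) ^ alpha d k = (?w ^ r) ^ (k choose 2)"
      using nz by (simp add: power_int_minus power_inverse field_simps)
    with 1 show ?thesis by (simp add: chirp_def mult.commute)
  qed
  moreover have "{0..d - 1} = {..<d}" using d by auto
  ultimately show ?thesis
    by (simp add: Xfam_def chirp_mat_def)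
qed

section \<open>Unitarity and inner products of the chirp matrices\<close>

lemma unitary_chirp_mat:
  fixes X :: "complex^'n^'n"
  assumes X: "unitary_mat X" "mat_pow X d = mat 1"
    and q: "prime d" "odd d" "q ^ d = 1" "q \<noteq> 1" "z ^ d = 1" "cmod q = 1" "cmod z = 1"
  shows "unitary_mat (chirp_mat d X q z)"
proof (rule unitary_matI)
  have d: "0 < d" using q(2) by (rule odd_pos)
  let ?c = "chirp q z"
  let ?S = "\<Sum>k<d. ?c k *\<^sub>m mat_pow X k"
  \<comment> \<open>Because \<open>mat_pow X d = mat 1\<close>, the matrix terms are periodic too.
    Starting at k lets the adjoint of the k-th power cancel, leaving the m-th power of X.\<close>
  have shift: "?S = (\<Sum>m<d. ?c (k + m) *\<^sub>m mat_pow X (k + m))" for k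
    using sum_periodic_shift [of "\<lambda>k. ?c k *\<^sub>m mat_pow X k" d k] X(2)
    by (simp add: mat_pow_add chirp_periodic q)
  have "ctranspose (mat_pow X k) ** mat_pow X (k + m) = mat_pow X m" for k m
    using unitary_mat_pow [OF X(1), of k]
    by (simp add: mat_pow_add matrix_mul_assoc unitary_mat_def)
  then have row: "(cnj (?c k) *\<^sub>m ctranspose (mat_pow X k)) ** ?S
      = (\<Sum>m<d. (cnj (?c k) * ?c (k + m)) *\<^sub>m mat_pow X m)" for k
    by (subst shift [of k]) (simp add: matrix_mult_sum_right matrix_mult_scale_left
        matrix_mult_scale_right mult.commute)
  have "ctranspose ?S ** ?S = (\<Sum>k<d. \<Sum>m<d. (cnj (?c k) * ?c (k + m)) *\<^sub>m mat_pow X m)"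
    unfolding ctranspose_sum ctranspose_scale matrix_mult_sum_left row ..
  \<comment> \<open>The coefficient of each power of X is now an autocorrelation, so only the
    identity survives.\<close>
  also have "\<dots> = (\<Sum>m<d. (\<Sum>k<d. cnj (?c k) * ?c (k + m)) *\<^sub>m mat_pow X m)"
    by (subst sum.swap) (simp add: cmat.scale_sum_left)
  also have "\<dots> = (\<Sum>m<d. if m = 0 then of_nat d *\<^sub>m mat 1 else 0)"
    using q by (intro sum.cong) (simp_all add: chirp_autocorrelation)
  also have "\<dots> = of_nat d *\<^sub>m mat 1"
    using d by simp
  finally have "ctranspose (chirp_mat d X q z) ** chirp_mat d X q z
      = (complex_of_real (1 / sqrt d) * (complex_of_real (1 / sqrt d) * of_nat d)) *\<^sub>m mat 1"
    by (simp add: chirp_mat_def ctranspose_scale matrix_mult_scale_left matrix_mult_scale_right)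
  also have "complex_of_real (1 / sqrt d) * (complex_of_real (1 / sqrt d) * of_nat d)
      = complex_of_real (1 / sqrt d * (1 / sqrt d * real d))"
    by (simp only: of_real_mult of_real_of_nat_eq)
  also have "1 / sqrt d * (1 / sqrt d * real d) = 1"
    using d by (simp add: field_simps)
  finally show "ctranspose (chirp_mat d X q z) ** chirp_mat d X q z = mat 1"
    by simp
qed

lemma chirp_mat_in_span: "chirp_mat d X q z \<in> cmat.span (mat_pow X ` {..<d})"
  unfolding chirp_mat_def
  by (intro cmat.span_scale cmat.span_sum cmat.span_base) auto

text \<open>Orthogonality of the powers extracts one coefficient, and the normalisation turns the
  Gram factor d into sqrt d. With unimodular q and z, every overlap with a power of X thus has
  squared modulus d.\<close>

lemma hs_inner_mat_pow_chirp_mat: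
  assumes gram: "\<And>k l. k < d \<Longrightarrow> l < d \<Longrightarrow>
      hs_inner (mat_pow X k) (mat_pow X l) = (if k = l then of_nat d else 0)"
    and "i < d"
  shows "hs_inner (mat_pow X i) (chirp_mat d X q z) = complex_of_real (sqrt d) * chirp q z i"
proof -
  have "(\<Sum>l<d. chirp q z l * hs_inner (mat_pow X i) (mat_pow X l))
      = (\<Sum>l<d. if l = i then chirp q z i * of_nat d else 0)"
    using assms by (intro sum.cong) auto
  also have "\<dots> = of_nat d * chirp q z i"
    using assms(2) by simp
  finally have "hs_inner (mat_pow X i) (chirp_mat d X q z)
      = complex_of_real (1 / sqrt d * real d) * chirp q z i"
    by (simp add: chirp_mat_def hs_inner_scale_right hs_inner_sum_right)
  also have "1 / sqrt d * real d = sqrt d"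
    by (simp add: real_div_sqrt)
  finally show ?thesis .
qed

text \<open>The result is a chirp sum in the quotients of the parameters when q and z are
  unimodular: a geometric sum if q = q', and otherwise a Gauss sum handled by
  \<open>norm_sum_chirp\<close>.\<close>

lemma hs_inner_chirp_mat:
  assumes gram: "\<And>k l. k < d \<Longrightarrow> l < d \<Longrightarrow>
      hs_inner (mat_pow X k) (mat_pow X l) = (if k = l then of_nat d else 0)"
    and "0 < d"
  shows "hs_inner (chirp_mat d X q z) (chirp_mat d X q' z')
      = (\<Sum>k<d. chirp (cnj q * q') (cnj z * z') k)"
proof -
  have "hs_inner (chirp_mat d X q z) (chirp_mat d X q' z')
      = complex_of_real (1 / sqrt d) *
        (\<Sum>k<d. cnj (chirp q z k) * hs_inner (mat_pow X k) (chirp_mat d X q' z'))"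
    by (simp add: chirp_mat_def [of d X q z] hs_inner_scale_left hs_inner_sum_left)
  also have "\<dots> = complex_of_real (1 / sqrt d) *
      (\<Sum>k<d. complex_of_real (sqrt d) * chirp (cnj q * q') (cnj z * z') k)"
    using hs_inner_mat_pow_chirp_mat [OF gram]
    by (simp add: mult.left_commute flip: cnj_chirp_mult)
  also have "\<dots> = complex_of_real (1 / sqrt d * sqrt d) *
      (\<Sum>k<d. chirp (cnj q * q') (cnj z * z') k)"
    by (simp only: of_real_mult mult.assoc sum_distrib_left)
  also have "1 / sqrt d * sqrt d = 1"
    using assms(2) by simp
  finally show ?thesis by simp
qed

theorem mainTheorem2:
  fixes X :: "complex^'n^'n" and d :: nat and Ms :: "(complex^'n^'n) set"
  assumes "d = CARD('n)" and "prime d" and "d > 2"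
    and "unitary_mat X"
    and "mat_pow X d = mat 1"
    and "\<And>i j. i < d \<Longrightarrow> j < d \<Longrightarrow> i \<noteq> j \<Longrightarrow>
           trace (mat_pow X i ** ctranspose (mat_pow X j)) = 0"
    and "Ms = cmat.span (mat_pow X ` {..<d})"
  shows "(\<forall>r\<in>{1..d - 1}. orthogonal_unitary_basis d Ms (Xfam d X r)) \<and>
    (\<forall>r\<in>{1..d - 1}. MUUB d Ms (mat_pow X) (Xfam d X r)) \<and>
    (\<forall>r\<in>{1..d - 1}. \<forall>r'\<in>{1..d - 1}. r \<noteq> r' \<longrightarrow> MUUB d Ms (Xfam d X r) (Xfam d X r'))"
proof -
  let ?w = "root_unity d"
  have d: "0 < d" "1 < CARD('n)" and odd: "odd d"
    using assms(1-3) prime_odd_nat by auto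
  have period: "?w ^ d = 1" "cnj ?w ^ d = 1" "cnj ?w * ?w = 1"
    using root_unity_power_period [OF d(1)] norm_root_unity [of d] complex_norm_square [of ?w]
    by (simp_all add: mult.commute flip: complex_cnj_power)
  have powers: "(?w ^ n) ^ d = 1" "(cnj ?w ^ n) ^ d = 1" "cmod (?w ^ n) = 1" "cmod (cnj ?w ^ n) = 1"
    "cnj (?w ^ n) * ?w ^ n = 1" for n
    using period norm_root_unity [of d]
    by (simp_all add: norm_power power_mult [of _ d n] mult.commute [of n d]
        flip: power_mult [of _ n d] power_mult_distrib)
  have distinct: "?w ^ i \<noteq> ?w ^ j" if "i < d" "j < d" "i \<noteq> j" for i j
    using that root_unity_power_eq_iff [OF d(1)] by simp
  have ne_1: "?w ^ r \<noteq> 1" if "r \<in> {1..d - 1}" for r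
    proof -
    have "r < d" "r \<noteq> 0" using that d(1) by auto
    then show ?thesis using distinct [of r 0] d(1) by simp
  qed
  \<comment> \<open>The conjugate of a power of \<omega> is its inverse, so a quotient equal to 1
    would identify two distinct powers.\<close>
  have quotient_ne_1: "cnj (?w ^ i) * ?w ^ j \<noteq> 1" if "i < d" "j < d" "i \<noteq> j" for i j
    by (metis distinct [OF that] powers(5) mult.commute mult.right_neutral mult.left_commute)

  note eq = Xfam_eq_chirp_mat [OF odd]
  note unit_pow = unitary_mat_pow [OF assms(4)]
  \<comment> \<open>The hypothesis has the adjoint on the right; cyclicity of the trace moves it to
    the left, which is why the indices are swapped.\<close>
  have gram: "hs_inner (mat_pow X k) (mat_pow X l) = (if k = l then of_nat d else 0)"
    if "k < d" "l < d" for k l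
    using assms(6) [OF that(2,1)] hs_inner_unitary_self [OF unit_pow, of k] assms(1)
    by (auto simp: hs_inner_def trace_mul_sym [of "ctranspose (mat_pow X k)"])
  have inner_pow: "hs_inner (mat_pow X i) (chirp_mat d X q z) = complex_of_real (sqrt d) * chirp q z i"
    if "i < d" for i q z
    using gram that by (rule hs_inner_mat_pow_chirp_mat)
  have inner_chirp: "hs_inner (chirp_mat d X q z) (chirp_mat d X q' z')
      = (\<Sum>k<d. chirp (cnj q * q') (cnj z * z') k)" for q z q' z'
    using gram d(1) by (rule hs_inner_chirp_mat)
  have basis0: "orthogonal_unitary_basis d Ms (mat_pow X)"
    unfolding assms(7) using gram unit_pow
    by (intro orthogonal_unitary_basisI) (auto intro: cmat.span_base)
  have basis: "orthogonal_unitary_basis d Ms (Xfam d X r)" if r: "r \<in> {1..d - 1}" for r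
    unfolding assms(7)
  proof (rule orthogonal_unitary_basisI)
    fix s assume "s < d"
    show "unitary_mat (Xfam d X r s)"
      unfolding eq using powers ne_1 [OF r] assms(2,4,5) odd by (intro unitary_chirp_mat) simp_all
    show "Xfam d X r s \<in> cmat.span (mat_pow X ` {..<d})"
      unfolding eq by (rule chirp_mat_in_span)
  next
    fix s t assume st: "s < d" "t < d" "s \<noteq> t"
    \<comment> \<open>For equal r the quadratic parameters cancel to 1. What remains is a geometric
      sum whose ratio is this quotient of linear parameters.\<close>
    let ?u = "cnj (cnj ?w ^ s) * cnj ?w ^ t"
    have "?u \<noteq> 1"
      using quotient_ne_1 [OF st(2,1)] st(3) by (simp add: mult.commute)
    moreover have "?u ^ d = 1"
      using powers by (simp add: power_mult_distrib)
    ultimately have "(\<Sum>k<d. ?u ^ k) = 0" by (intro sum_powers_root_of_unity)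
    then show "hs_inner (Xfam d X r s) (Xfam d X r t) = 0"
      unfolding eq inner_chirp powers(5) by (simp add: chirp_def)
  qed
  have "MUUB d Ms (mat_pow X) (Xfam d X r)" if r: "r \<in> {1..d - 1}" for r
  proof (rule MUUBI [OF basis0 basis [OF r] d])
    fix i s assume "i < d" "s < d"
    then show "(cmod (hs_inner (mat_pow X i) (Xfam d X r s)))\<^sup>2 = CARD('n)"
      unfolding eq inner_pow [OF \<open>i < d\<close>]
      using norm_chirp [OF powers(3,4)] assms(1) by (simp add: norm_mult)
  qed
  moreover have "MUUB d Ms (Xfam d X r) (Xfam d X r')"
    if r: "r \<in> {1..d - 1}" "r' \<in> {1..d - 1}" "r \<noteq> r'" for r r'
  proof (rule MUUBI [OF basis [OF r(1)] basis [OF r(2)] d])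
    fix s t
    have "r < d" "r' < d"
      using r(1,2) d(1) by auto
    \<comment> \<open>For distinct r and r' the quadratic parameter stays nontrivial, as
      \<open>norm_sum_chirp\<close> requires. The linear one may be any d-th root of unity, so s and
      t are arbitrary.\<close>
    then have "cnj (?w ^ r) * ?w ^ r' \<noteq> 1"
      using r(3) by (rule quotient_ne_1)
    then show "(cmod (hs_inner (Xfam d X r s) (Xfam d X r' t)))\<^sup>2 = CARD('n)"
      unfolding eq inner_chirp assms(1) [symmetric]
      using powers assms(2) odd
      by (intro norm_sum_chirp) (simp_all add: power_mult_distrib norm_mult)
  qed
  ultimately show ?thesis
    using basis by blast
qed

end
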